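(* Let $P$ be a $d$-polytope and let $P(n)$, $P(n)^\sharp$ be the $V(P)$-polytope numbers and interior polytope numbers. Then $P(0)=P(0)^\sharp=|\emptyset|=0$, $P(1)=|\{\mathbf{0}\}|=1$, $P(1)^\sharp=|\{\mathbf 0\}|=1$ if $d=0$ and $P(1)^\sharp=|\emptyset|=0$ if $d\ge1$, and for every $n\ge2$ $$P(n)=\bigg|\bigg\{\sum_{i=1}^{n-1}\mathbf{v}_{F_i} : F_1\supseteq F_2\supseteq\cdots\supseteq F_{n-1}\bigg\}\bigg|,$$ $$P(n)^{\sharp}=\bigg|\bigg\{\sum_{i=1}^{n-1}\mathbf{v}_{F_i} : F_1\supseteq F_2\supseteq\cdots\supseteq F_{n-1},\ conv\big(\{\mathbf{v}_{F_1},\mathbf{v}_{F_2},\ldots,\mathbf{v}_{F_{n-1}}\}\big)\not\subseteq\partial P\bigg\}\bigg|,$$ where the $F_i$ range over nonempty faces of $P$ (with $P$ itself allowed).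
   Context: A $d$-polytope is a $d$-dimensional convex hull of finitely many points in some $\mathbb{R}^e$. $\partial P$ is the union of the proper faces of $P$. Apexes: let $\mathbf{c}\mathbf{x}$ be a linear function taking distinct values at distinct vertexes of $P$. For each nonempty face $F$ of $P$ (including $P$) let the apex $\mathbf{v}_F$ be the unique vertex of $F$ at which $\mathbf{c}\mathbf{x}$ attains its minimum on $F$; $V(P)$ denotes this system of apexes. Polytope numbers: let $\mathcal{F}(P)$ be the set of nonempty faces of $P$, including $P$. The $V(P)$-polytope numbers $P(n)$ and interior polytope numbers $P(n)^\sharp$ are defined by double induction on $d=\dim P$ and $n\ge0$ (each face is a polytope with the inherited apexes): if $d=0$, $P(0)=P(0)^\sharp=0$ and $P(n)=P(n)^\sharp=1$ for $n\ge1$; if $d\ge1$, $P(0)=0$, $P(1)=1$, $P(0)^\sharp=P(1)^\sharp=0$, and for $n\ge2$ $$P(n)=P(n-1)+\sum_{F\in\mathcal{F}(P),\ \mathbf{v}_P\notin F}F(n)^\sharp,\qquad P(n)^\sharp=P(n)-\sum_{F\in\mathcal{F}(P)\setminus\{P\}}F(n)^\sharp .$$ *)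

theory Defs
  imports "HOL-Analysis.Analysis"
begin

definition vertices :: "'a::euclidean_space set \<Rightarrow> 'a set" where
  "vertices P = {v. v extreme_point_of P}"

definition nonempty_faces :: "'a::euclidean_space set \<Rightarrow> 'a set set" where
  "nonempty_faces P = {F. F face_of P \<and> F \<noteq> {}}"

text \<open>The empty set is a face in the sense of \<^const>\<open>face_of\<close>; it contributes nothing to this union.\<close>

definition polytope_boundary :: "'a::euclidean_space set \<Rightarrow> 'a set" where
  "polytope_boundary P = \<Union>{F. F face_of P \<and> F \<noteq> P}"

definition generic_on :: "'a::euclidean_space \<Rightarrow> 'a set \<Rightarrow> bool" where
  "generic_on c P \<longleftrightarrow> inj_on (\<lambda>x. c \<bullet> x) (vertices P)"

definition apex :: "'a::euclidean_space \<Rightarrow> 'a set \<Rightarrow> 'a" where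
  "apex c F = (THE v. v \<in> vertices F \<and> (\<forall>x\<in>F. c \<bullet> v \<le> c \<bullet> x))"

lemma apex_unique_exists:
  fixes F :: "'a::euclidean_space set"
  assumes "polytope F" "F \<noteq> {}" "generic_on c F"
  shows "\<exists>!v. v \<in> vertices F \<and> (\<forall>x\<in>F. c \<bullet> v \<le> c \<bullet> x)"
proof -
  have comp: "compact F" and conv: "convex F"
    using assms(1) by (auto simp: polytope_imp_compact polytope_imp_convex)
  have "continuous_on F (\<lambda>x. c \<bullet> x)"
    by (intro continuous_intros)
  then obtain m where m: "m \<in> F" "\<And>x. x \<in> F \<Longrightarrow> c \<bullet> m \<le> c \<bullet> x"
    using continuous_attains_inf[OF comp assms(2)] by blast
  define G where "G = F \<inter> {x. c \<bullet> x = c \<bullet> m}"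
  have G: "G face_of F"
    unfolding G_def by (rule face_of_Int_supporting_hyperplane_ge[OF conv]) (use m in auto)
  have "polytope G" "G \<noteq> {}"
    using face_of_polytope_polytope[OF assms(1) G] m by (auto simp: G_def)
  then obtain v where v: "v extreme_point_of G"
    using extreme_point_exists_convex[of G] polytope_imp_compact polytope_imp_convex by blast
  then have "v \<in> vertices F" "v \<in> G"
    using extreme_point_of_face[OF G] by (auto simp: vertices_def)
  then have ex: "v \<in> vertices F \<and> (\<forall>x\<in>F. c \<bullet> v \<le> c \<bullet> x)"
    using m by (auto simp: G_def)
  show ?thesis
  proof (rule ex1I, rule ex)
    fix w assume w: "w \<in> vertices F \<and> (\<forall>x\<in>F. c \<bullet> w \<le> c \<bullet> x)"
    then have "w \<in> F" "v \<in> F"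
      using ex by (auto simp: vertices_def extreme_point_of_def)
    then have "c \<bullet> w = c \<bullet> v"
      using w ex by (simp add: order_antisym)
    then show "w = v"
      using assms(3) w ex by (auto simp: generic_on_def inj_on_def)
  qed
qed

lemma apex_in:
  assumes "polytope F" "F \<noteq> {}" "generic_on c F"
  shows "apex c F \<in> F"
  using theI'[OF apex_unique_exists[OF assms]]
  by (auto simp: apex_def vertices_def extreme_point_of_def)

lemma generic_on_face:
  assumes "generic_on c P" "F face_of P"
  shows "generic_on c F"
  using assms extreme_point_of_face[OF assms(2)]
  by (auto simp: generic_on_def vertices_def inj_on_def)

text \<open>The first test in each equation only assigns the junk value 0 outside the domain
  (nonempty polytopes on whose vertices \<^term>\<open>c\<close> is injective).  That domain is closed under
  passing to nonempty faces, see lemma \<open>face_in_domain\<close> below, so the recursion never meets the junk value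
  when started inside the domain.  Values are integers since the interior numbers are defined by a
  subtraction.\<close>

function polytope_number :: "'a::euclidean_space \<Rightarrow> 'a set \<Rightarrow> nat \<Rightarrow> int"
  and interior_polytope_number :: "'a::euclidean_space \<Rightarrow> 'a set \<Rightarrow> nat \<Rightarrow> int"
where
  "polytope_number c P n =
    (if \<not> (polytope P \<and> P \<noteq> {} \<and> generic_on c P) then 0
     else if aff_dim P = 0 then (if n = 0 then 0 else 1)
     else if n = 0 then 0
     else if n = 1 then 1
     else polytope_number c P (n - 1)
          + (\<Sum>F \<in> {F \<in> nonempty_faces P. apex c P \<notin> F}. interior_polytope_number c F n))"
| "interior_polytope_number c P n =
    (if \<not> (polytope P \<and> P \<noteq> {} \<and> generic_on c P) then 0
     else if aff_dim P = 0 then (if n = 0 then 0 else 1)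
     else if n \<le> 1 then 0
     else polytope_number c P n
          - (\<Sum>F \<in> nonempty_faces P - {P}. interior_polytope_number c F n))"
  by pat_completeness auto

termination
proof (relation "inv_image (less_than <*lex*> less_than <*lex*> less_than)
    (\<lambda>s. case s of Inl (c, P, n) \<Rightarrow> (nat (aff_dim P), n, 0)
                 | Inr (c, P, n) \<Rightarrow> (nat (aff_dim P), n, Suc 0))", goal_cases)
  have dim: "nat (aff_dim F) < nat (aff_dim P)"
    if "polytope P" "F face_of P" "F \<noteq> P" "P \<noteq> {}" "aff_dim P \<noteq> 0" for F P :: "'a set"
  proof -
    have "aff_dim F < aff_dim P"
      using face_of_aff_dim_lt that polytope_imp_convex by blast
    moreover have "\<not> aff_dim P < 0"
      using that by (simp add: aff_dim_negative_iff)
    ultimately show ?thesis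
      using that by linarith
  qed
  {
    case 1
    show ?case by (intro wf_inv_image wf_lex_prod wf_less_than)
  next
    case (2 c P n)
    then show ?case by simp
  next
    case (3 c P n F)
    then have "F \<noteq> P"
      using apex_in by blast
    then show ?case using 3 dim[of P F] by (auto simp: nonempty_faces_def)
  next
    case (4 c P n)
    then show ?case by simp
  next
    case (5 c P n F)
    then show ?case using dim[of P F] by (auto simp: nonempty_faces_def)
  }
qed

declare polytope_number.simps [simp del] interior_polytope_number.simps [simp del]

lemma face_in_domain:
  assumes "polytope P" "generic_on c P" "F \<in> nonempty_faces P"
  shows "polytope F \<and> F \<noteq> {} \<and> generic_on c F"
  using assms generic_on_face face_of_polytope_polytope by (auto simp: nonempty_faces_def)

text \<open>\<^term>\<open>face_chain P m F\<close>: the family \<open>F 1, ..., F m\<close> is a weakly decreasing chain of nonempty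
  faces.  Values of \<^term>\<open>F\<close> at other indices are irrelevant.\<close>

definition face_chain :: "'a::euclidean_space set \<Rightarrow> nat \<Rightarrow> (nat \<Rightarrow> 'a set) \<Rightarrow> bool" where
  "face_chain P m F \<longleftrightarrow>
    (\<forall>i\<in>{1..m}. F i \<in> nonempty_faces P) \<and> (\<forall>i\<in>{1..<m}. F (Suc i) \<subseteq> F i)"

end

theory Submission
  imports Defs
begin

text \<open>
  Let \<open>A P m\<close> be the set of sums of \<open>m\<close> apexes along weakly decreasing chains of faces, and let \<open>I P m\<close>
  consist of those sums \<open>x\<close> for which \<open>x / m\<close> is not in the boundary of \<open>P\<close>.  A face of \<open>P\<close> contains
  the average of points of \<open>P\<close> only if it contains all of them, and intersecting a chain with a face
  that contains all its apexes does not change the apexes.  Hence \<open>A P m\<close> is the disjoint union of the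
  sets \<open>I F m\<close> over all nonempty faces \<open>F\<close>.  If the largest face of a chain contains the apex of \<open>P\<close>,
  that apex is a summand and can be split off; otherwise the sum comes from a face avoiding the apex
  of \<open>P\<close>.  So \<open>A P (m + 1)\<close> is the disjoint union of a translate of \<open>A P m\<close> and the sets \<open>I F (m + 1)\<close>
  over the faces \<open>F\<close> avoiding the apex.  These two partitions are the recursions of the polytope
  numbers.
\<close>

section \<open>Averages and apexes in faces\<close>

text \<open>A face of a polytope is exposed, so \<open>F\<close> is the set where some linear
  functional attains an upper bound \<open>b\<close> valid on \<open>P\<close>. An average attains
  \<open>b\<close> only if every term does, since the nonnegative defects
  \<open>b - a \<bullet> v i\<close> sum to zero. The converse is convexity of
  \<open>F\<close>.\<close>

lemma average_in_face_iff:
  fixes P :: "'a::euclidean_space set"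
  assumes "polytope P" "F face_of P" "finite J" "J \<noteq> {}" "\<And>i. i \<in> J \<Longrightarrow> v i \<in> P"
  shows "(1 / real (card J)) *\<^sub>R (\<Sum>i\<in>J. v i) \<in> F \<longleftrightarrow> (\<forall>i\<in>J. v i \<in> F)"
proof
  have card: "real (card J) > 0"
    using assms(3,4) by (simp add: card_gt_0_iff)
  {
    assume F: "(1 / real (card J)) *\<^sub>R (\<Sum>i\<in>J. v i) \<in> F"
    have "F exposed_face_of P"
      using assms(1,2) exposed_face_of_polyhedron polytope_imp_polyhedron by blast
    then obtain a b where ab: "P \<subseteq> {x. a \<bullet> x \<le> b}" "F = P \<inter> {x. a \<bullet> x = b}"
      unfolding exposed_face_of_def by blast
    have "a \<bullet> ((1 / real (card J)) *\<^sub>R (\<Sum>i\<in>J. v i)) = b"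
      using F ab(2) by blast
    then have "(\<Sum>i\<in>J. a \<bullet> v i) = real (card J) * b"
      using card by (simp add: inner_sum_right field_simps)
    then have "(\<Sum>i\<in>J. b - a \<bullet> v i) = 0"
      by (simp add: sum_subtractf)
    moreover have "\<forall>i\<in>J. 0 \<le> b - a \<bullet> v i"
      using ab(1) assms(5) by fastforce
    ultimately have "\<forall>i\<in>J. b - a \<bullet> v i = 0"
      using sum_nonneg_eq_0_iff[OF assms(3)] by (metis (no_types, lifting))
    then show "\<forall>i\<in>J. v i \<in> F"
      using ab(2) assms(5) by auto
  }
  {
    assume "\<forall>i\<in>J. v i \<in> F"
    moreover have "convex F"
      using assms(2) face_of_imp_convex polytope_imp_convex[OF assms(1)] by blast
    ultimately have "(\<Sum>i\<in>J. (1 / real (card J)) *\<^sub>R v i) \<in> F"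
      using card by (intro convex_sum[OF assms(3)]) auto
    then show "(1 / real (card J)) *\<^sub>R (\<Sum>i\<in>J. v i) \<in> F"
      by (simp add: scaleR_sum_right)
  }
qed

text \<open>The minimizer over \<open>P\<close> still minimizes over the smaller set
  \<open>F\<close>, and a vertex of \<open>P\<close> lying in a face is a vertex of that face;
  uniqueness of the apex does the rest.\<close>

lemma apex_face_eq:
  assumes P: "polytope P" "generic_on c P" and F: "F face_of P" and in_F: "apex c P \<in> F"
  shows "apex c F = apex c P"
proof -
  have ne: "P \<noteq> {}"
    using F in_F face_of_imp_subset by blast
  have dom: "polytope F" "F \<noteq> {}" "generic_on c F"
    using face_in_domain[OF P, of F] F in_F by (auto simp: nonempty_faces_def)
  have "apex c P \<in> vertices P \<and> (\<forall>x\<in>P. c \<bullet> apex c P \<le> c \<bullet> x)"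
    using theI'[OF apex_unique_exists[OF P(1) ne P(2)]] by (simp add: apex_def)
  then have "apex c P \<in> vertices F \<and> (\<forall>x\<in>F. c \<bullet> apex c P \<le> c \<bullet> x)"
    using F in_F face_of_imp_subset[OF F] extreme_point_of_face[OF F] by (auto simp: vertices_def)
  then show ?thesis
    unfolding apex_def[of c F] by (rule the1_equality[OF apex_unique_exists[OF dom]])
qed

lemma apex_nonempty_face_in:
  assumes "polytope P" "generic_on c P" "F \<in> nonempty_faces P"
  shows "apex c F \<in> F"
  using face_in_domain[OF assms] apex_in by blast

lemma finite_nonempty_faces: "polytope P \<Longrightarrow> finite (nonempty_faces P)"
  using finite_subset[OF _ finite_polytope_faces, of "nonempty_faces P" P]
  by (auto simp: nonempty_faces_def)

lemma nonempty_faces_trans: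
  "F \<in> nonempty_faces P \<Longrightarrow> G \<in> nonempty_faces F \<Longrightarrow> G \<in> nonempty_faces P"
  by (auto simp: nonempty_faces_def intro: face_of_trans)

lemma self_in_nonempty_faces: "polytope P \<Longrightarrow> P \<noteq> {} \<Longrightarrow> P \<in> nonempty_faces P"
  by (simp add: nonempty_faces_def face_of_refl polytope_imp_convex)

section \<open>Chains of faces and sums of their apexes\<close>

lemma face_chain_subset_first:
  assumes "face_chain P m F" "i \<in> {1..m}"
  shows "F i \<subseteq> F 1"
proof -
  have "i \<le> m \<longrightarrow> F i \<subseteq> F 1" if "1 \<le> i" for i
    using that
  proof (induction i rule: dec_induct)
    case (step i)
    show ?case
    proof
      assume "Suc i \<le> m"
      then have "F (Suc i) \<subseteq> F i"
        using assms(1) step.hyps by (simp add: face_chain_def)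
      also have "F i \<subseteq> F 1"
        using step.IH \<open>Suc i \<le> m\<close> by simp
      finally show "F (Suc i) \<subseteq> F 1" .
    qed
  qed simp
  then show ?thesis using assms(2) by auto
qed

lemma face_chain_subset:
  assumes "face_chain P m F" "i \<in> {1..m}"
  shows "F i \<subseteq> P"
proof -
  have "F i \<in> nonempty_faces P"
    using assms unfolding face_chain_def by blast
  then show ?thesis
    by (simp add: nonempty_faces_def face_of_imp_subset)
qed

lemma face_chain_face_imp:
  assumes "face_chain F m G" "F \<in> nonempty_faces P"
  shows "face_chain P m G"
  using assms nonempty_faces_trans unfolding face_chain_def by blast

lemma face_chain_Suc_imp: "face_chain P (Suc m) F \<Longrightarrow> face_chain P m F"
  by (auto simp: face_chain_def)

lemma face_chain_tail: "face_chain P (Suc m) F \<Longrightarrow> face_chain P m (\<lambda>i. F (Suc i))"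
  by (auto simp: face_chain_def)

definition chain_sums :: "'a::euclidean_space \<Rightarrow> 'a set \<Rightarrow> nat \<Rightarrow> 'a set" where
  "chain_sums c P m = {(\<Sum>i=1..m. apex c (F i)) | F. face_chain P m F}"

text \<open>Testing the average instead of the convex hull makes the condition depend on the sum
  alone, not on the chain that represents it. \<open>interior_chain_sums_eq\<close> recovers the
  hull form. For \<open>m = 0\<close> the factor \<open>1 / real m\<close> is 0 and the test is
  meaningless, hence the later assumptions \<open>m > 0\<close>.\<close>

definition interior_chain_sums :: "'a::euclidean_space \<Rightarrow> 'a set \<Rightarrow> nat \<Rightarrow> 'a set" where
  "interior_chain_sums c P m =
    {x \<in> chain_sums c P m. (1 / real m) *\<^sub>R x \<notin> polytope_boundary P}"

lemma chain_sums_0 [simp]: "chain_sums c P 0 = {0}"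
  by (auto simp: chain_sums_def face_chain_def)

lemma finite_chain_sums:
  assumes "polytope P"
  shows "finite (chain_sums c P m)"
proof (induction m)
  case (Suc m)
  have "chain_sums c P (Suc m) \<subseteq> (\<lambda>(x, F). x + apex c F) ` (chain_sums c P m \<times> nonempty_faces P)"
  proof
    fix x assume "x \<in> chain_sums c P (Suc m)"
    then obtain F where F: "face_chain P (Suc m) F" and x: "x = (\<Sum>i=1..Suc m. apex c (F i))"
      by (auto simp: chain_sums_def)
    have "(\<Sum>i=1..m. apex c (F i)) \<in> chain_sums c P m"
      using face_chain_Suc_imp[OF F] by (auto simp: chain_sums_def)
    moreover have "F (Suc m) \<in> nonempty_faces P"
      using F by (auto simp: face_chain_def)
    ultimately show "x \<in> (\<lambda>(x, F). x + apex c F) ` (chain_sums c P m \<times> nonempty_faces P)"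
      unfolding x by force
  qed
  then show ?case
    using Suc finite_nonempty_faces[OF assms] by (meson finite_SigmaI finite_imageI finite_subset)
qed simp

section \<open>Partition of the chain sums by faces\<close>

context
  fixes P :: "'a::euclidean_space set" and c :: 'a
  assumes P: "polytope P" and gen: "generic_on c P"
begin

lemma apex_chain_in:
  assumes "face_chain P m F" "i \<in> {1..m}"
  shows "apex c (F i) \<in> F i" "apex c (F i) \<in> P"
proof -
  have "F i \<in> nonempty_faces P"
    using assms by (auto simp: face_chain_def)
  then show "apex c (F i) \<in> F i" "apex c (F i) \<in> P"
    using apex_nonempty_face_in[OF P gen] face_of_imp_subset by (auto simp: nonempty_faces_def)
qed

lemma chain_average_in_face_iff:
  assumes "face_chain P m F" "m > 0" "G face_of P"
  shows "(1 / real m) *\<^sub>R (\<Sum>i=1..m. apex c (F i)) \<in> G \<longleftrightarrow> (\<forall>i\<in>{1..m}. apex c (F i) \<in> G)"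
  using average_in_face_iff[OF P assms(3), of "{1..m}" "\<lambda>i. apex c (F i)"]
    apex_chain_in(2)[OF assms(1)] assms(2) by auto

text \<open>Whether a sum comes from a chain inside \<open>G\<close> is decided by the position of
  its average: if that lies in \<open>G\<close>, all apexes do, and replacing each
  \<open>F i\<close> by \<open>F i \<inter> G\<close> moves the chain into \<open>G\<close> without
  changing the sum.\<close>

lemma chain_sums_face:
  assumes G: "G \<in> nonempty_faces P" and m: "m > 0"
  shows "chain_sums c G m = {x \<in> chain_sums c P m. (1 / real m) *\<^sub>R x \<in> G}"
proof (intro equalityI subsetI)
  fix x assume "x \<in> chain_sums c G m"
  then obtain F where F: "face_chain G m F" and x: "x = (\<Sum>i=1..m. apex c (F i))"
    by (auto simp: chain_sums_def)
  have PF: "face_chain P m F"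
    using face_chain_face_imp[OF F G] .
  have "apex c (F i) \<in> G" if "i \<in> {1..m}" for i
  proof -
    show ?thesis
      using apex_chain_in(1)[OF PF that] face_chain_subset[OF F that] by blast
  qed
  then show "x \<in> {x \<in> chain_sums c P m. (1 / real m) *\<^sub>R x \<in> G}"
    using PF chain_average_in_face_iff[OF PF m, of G] G x
    by (auto simp: chain_sums_def nonempty_faces_def)
next
  fix x assume "x \<in> {x \<in> chain_sums c P m. (1 / real m) *\<^sub>R x \<in> G}"
  then obtain F where F: "face_chain P m F" and x: "x = (\<Sum>i=1..m. apex c (F i))"
    and "(1 / real m) *\<^sub>R x \<in> G"
    by (auto simp: chain_sums_def)
  then have inG: "apex c (F i) \<in> G" if "i \<in> {1..m}" for i
    using chain_average_in_face_iff[OF F m, of G] G that by (auto simp: nonempty_faces_def)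
  have Gf: "G face_of P"
    using G by (simp add: nonempty_faces_def)
  have Ff: "F i face_of P" "F i \<in> nonempty_faces P" if "i \<in> {1..m}" for i
    using F that by (auto simp: face_chain_def nonempty_faces_def)
  have eq: "apex c (F i \<inter> G) = apex c (F i)" if i: "i \<in> {1..m}" for i
  proof (rule apex_face_eq)
    show "polytope (F i)" "generic_on c (F i)"
      using face_in_domain[OF P gen Ff(2)[OF i]] by auto
    show "F i \<inter> G face_of F i"
      using Ff(1)[OF i] Gf by (meson Int_lower1 face_of_Int face_of_imp_subset face_of_subset)
    show "apex c (F i) \<in> F i \<inter> G"
      using inG[OF i] apex_chain_in(1)[OF F i] by blast
  qed
  have "F i \<inter> G \<in> nonempty_faces G" if i: "i \<in> {1..m}" for i
  proof -
    have "F i \<inter> G face_of G"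
      using Ff(1)[OF i] Gf by (meson Int_lower2 face_of_Int face_of_imp_subset face_of_subset)
    then show ?thesis
      using inG[OF i] apex_chain_in(1)[OF F i] by (auto simp: nonempty_faces_def)
  qed
  then have "face_chain G m (\<lambda>i. F i \<inter> G)"
    using F by (fastforce simp: face_chain_def)
  moreover have "x = (\<Sum>i=1..m. apex c (F i \<inter> G))"
    unfolding x using eq by (intro sum.cong) auto
  ultimately show "x \<in> chain_sums c G m"
    by (auto simp: chain_sums_def)
qed

text \<open>The average of a common sum lies in \<open>F \<inter> G\<close>, a face of both. As it
  avoids the boundary of each, \<open>F \<inter> G\<close> is proper in neither.\<close>

lemma interior_chain_sums_disjoint:
  assumes "F \<in> nonempty_faces P" "G \<in> nonempty_faces P" "F \<noteq> G" "m > 0"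
  shows "interior_chain_sums c F m \<inter> interior_chain_sums c G m = {}"
proof -
  have "F' \<subseteq> G'"
    if "F' \<in> nonempty_faces P" "G' \<in> nonempty_faces P"
      and x: "x \<in> interior_chain_sums c F' m" "x \<in> interior_chain_sums c G' m" for x F' G'
  proof -
    have "(1 / real m) *\<^sub>R x \<in> F' \<inter> G'"
      using x chain_sums_face[OF that(1) assms(4)] chain_sums_face[OF that(2) assms(4)]
      by (auto simp: interior_chain_sums_def)
    moreover have "F' \<inter> G' face_of F'"
      using that(1,2) unfolding nonempty_faces_def
      by (metis (no_types, lifting) Int_lower1 face_of_Int face_of_imp_subset face_of_subset
          mem_Collect_eq)
    ultimately have "F' \<inter> G' = F'"
      using x(1) by (auto simp: interior_chain_sums_def polytope_boundary_def)
    then show ?thesis by blast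
  qed
  then show ?thesis
    using assms by blast
qed

lemma chain_sums_eq_UN_interior:
  assumes "m > 0"
  shows "chain_sums c P m = (\<Union>F\<in>nonempty_faces P. interior_chain_sums c F m)"
proof (intro equalityI subsetI)
  fix x assume "x \<in> (\<Union>F\<in>nonempty_faces P. interior_chain_sums c F m)"
  then show "x \<in> chain_sums c P m"
    using chain_sums_face[OF _ assms] by (auto simp: interior_chain_sums_def)
next
  fix x assume x: "x \<in> chain_sums c P m"
  let ?y = "(1 / real m) *\<^sub>R x"
  let ?S = "{F \<in> nonempty_faces P. ?y \<in> F}"
  obtain F where F: "face_chain P m F" and xF: "x = (\<Sum>i=1..m. apex c (F i))"
    using x by (auto simp: chain_sums_def)
  have "?y \<in> P"
    using chain_average_in_face_iff[OF F assms, of P] apex_chain_in(2)[OF F] P xF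
    by (simp add: face_of_refl polytope_imp_convex)
  then have "P \<in> ?S"
    using self_in_nonempty_faces[OF P] by blast
  \<comment> \<open>\<open>G\<close> is a minimal face containing the average; a proper face of
    \<open>G\<close> containing it would be a smaller such face of \<open>P\<close>.\<close>
  then obtain G where G: "G \<in> ?S" and min: "\<And>H. H \<in> ?S \<Longrightarrow> H \<subseteq> G \<Longrightarrow> H = G"
    using finite_has_minimal[of ?S] finite_nonempty_faces[OF P] by auto
  have "?y \<notin> polytope_boundary G"
  proof
    assume "?y \<in> polytope_boundary G"
    then obtain H where H: "H face_of G" "H \<noteq> G" "?y \<in> H"
      by (auto simp: polytope_boundary_def)
    then have "H \<in> ?S"
      using nonempty_faces_trans[of G P H] G by (auto simp: nonempty_faces_def)
    then show False
      using min H face_of_imp_subset by blast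
  qed
  then have "x \<in> interior_chain_sums c G m"
    using G x chain_sums_face[of G, OF _ assms] by (auto simp: interior_chain_sums_def)
  then show "x \<in> (\<Union>F\<in>nonempty_faces P. interior_chain_sums c F m)"
    using G by blast
qed

lemma card_UN_interior:
  assumes "S \<subseteq> nonempty_faces P" "m > 0"
  shows "card (\<Union>F\<in>S. interior_chain_sums c F m) = (\<Sum>F\<in>S. card (interior_chain_sums c F m))"
proof (rule card_UN_disjoint)
  show "finite S"
    using assms(1) finite_nonempty_faces[OF P] finite_subset by blast
  show "\<forall>F\<in>S. finite (interior_chain_sums c F m)"
    using assms(1) face_in_domain[OF P gen] finite_chain_sums
    unfolding interior_chain_sums_def by (metis finite_Collect_conjI Collect_mem_eq subsetD)
  show "\<forall>F\<in>S. \<forall>G\<in>S. F \<noteq> G \<longrightarrow> interior_chain_sums c F m \<inter> interior_chain_sums c G m = {}"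
    using assms interior_chain_sums_disjoint by blast
qed

lemma card_interior_chain_sums:
  assumes "P \<noteq> {}" "m > 0"
  shows "int (card (interior_chain_sums c P m)) = int (card (chain_sums c P m))
    - (\<Sum>F\<in>nonempty_faces P - {P}. int (card (interior_chain_sums c F m)))"
proof -
  have "card (chain_sums c P m) = (\<Sum>F\<in>nonempty_faces P. card (interior_chain_sums c F m))"
    using chain_sums_eq_UN_interior[OF assms(2)] card_UN_interior[OF order_refl assms(2)] by simp
  also have "\<dots> = card (interior_chain_sums c P m)
      + (\<Sum>F\<in>nonempty_faces P - {P}. card (interior_chain_sums c F m))"
    using self_in_nonempty_faces[OF P assms(1)] finite_nonempty_faces[OF P] by (rule sum.remove[rotated])
  finally show ?thesis by simp
qed

end

section \<open>Splitting off the apex of the polytope\<close>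

lemma chain_sums_Suc:
  assumes P: "polytope P" and gen: "generic_on c P" and ne: "P \<noteq> {}"
  shows "chain_sums c P (Suc m) = (+) (apex c P) ` chain_sums c P m \<union>
    (\<Union>F\<in>{F \<in> nonempty_faces P. apex c P \<notin> F}. interior_chain_sums c F (Suc m))"
    (is "_ = ?A \<union> ?B")
proof (intro equalityI subsetI)
  fix x assume "x \<in> chain_sums c P (Suc m)"
  then obtain F where F: "face_chain P (Suc m) F" and x: "x = (\<Sum>i=1..Suc m. apex c (F i))"
    by (auto simp: chain_sums_def)
  have F1: "F 1 \<in> nonempty_faces P"
    using F by (auto simp: face_chain_def)
  show "x \<in> ?A \<union> ?B"
  proof (cases "apex c P \<in> F 1")
    case True
    then have "apex c (F 1) = apex c P"
      using apex_face_eq[OF P gen] F1 by (auto simp: nonempty_faces_def)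
    then have "x = apex c P + (\<Sum>i=1..m. apex c (F (Suc i)))"
      unfolding x by (simp add: sum.atLeast_Suc_atMost sum.shift_bounds_cl_Suc_ivl del: sum.cl_ivl_Suc)
    then show ?thesis
      using face_chain_tail[OF F] by (auto simp: chain_sums_def)
  next
    case False
    \<comment> \<open>All apexes lie in \<open>F 1\<close>, so \<open>x\<close> is a chain sum of
      \<open>F 1\<close> and is interior to some face \<open>G\<close> of it; \<open>G\<close>
      avoids the apex of \<open>P\<close> because \<open>F 1\<close> does.\<close>
    have "apex c (F i) \<in> F 1" if "i \<in> {1..Suc m}" for i
      using apex_chain_in(1)[OF P gen F that] face_chain_subset_first[OF F that] by blast
    then have "(1 / real (Suc m)) *\<^sub>R x \<in> F 1"
      using chain_average_in_face_iff[OF P gen F, of "F 1"] F1 x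
      by (simp add: nonempty_faces_def del: sum.cl_ivl_Suc)
    then have "x \<in> chain_sums c (F 1) (Suc m)"
      using chain_sums_face[OF P gen F1, of "Suc m"] F x by (auto simp: chain_sums_def)
    then obtain G where G: "G \<in> nonempty_faces (F 1)" "x \<in> interior_chain_sums c G (Suc m)"
      using chain_sums_eq_UN_interior[of "F 1" c "Suc m"] face_in_domain[OF P gen F1] by blast
    moreover have "G \<subseteq> F 1"
      using G(1) face_of_imp_subset by (auto simp: nonempty_faces_def)
    ultimately show ?thesis
      using nonempty_faces_trans[OF F1 G(1)] False by blast
  qed
next
  fix x assume "x \<in> ?A \<union> ?B"
  then show "x \<in> chain_sums c P (Suc m)"
  proof
    assume "x \<in> ?A"
    then obtain F where F: "face_chain P m F" and x: "x = apex c P + (\<Sum>i=1..m. apex c (F i))"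
      by (auto simp: chain_sums_def)
    \<comment> \<open>Prepending \<open>P\<close> itself to the chain adds exactly the summand
      \<open>apex c P\<close>.\<close>
    have "face_chain P (Suc m) (\<lambda>i. if i = 1 then P else F (i - 1))"
      using F self_in_nonempty_faces[OF P ne] face_chain_subset[OF F]
      by (fastforce simp: face_chain_def)
    moreover have "x = (\<Sum>i=1..Suc m. apex c (if i = 1 then P else F (i - 1)))"
      unfolding x
      by (simp add: sum.atLeast_Suc_atMost sum.shift_bounds_cl_Suc_ivl del: sum.cl_ivl_Suc)
    ultimately show ?thesis
      unfolding chain_sums_def by (intro CollectI exI conjI)
  next
    assume "x \<in> ?B"
    then show ?thesis
      using chain_sums_eq_UN_interior[OF P gen, of "Suc m"] by blast
  qed
qed

lemma card_chain_sums_Suc: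
  assumes P: "polytope P" and gen: "generic_on c P" and ne: "P \<noteq> {}"
  shows "int (card (chain_sums c P (Suc m))) = int (card (chain_sums c P m)) +
    (\<Sum>F\<in>{F \<in> nonempty_faces P. apex c P \<notin> F}. int (card (interior_chain_sums c F (Suc m))))"
proof -
  let ?A = "(+) (apex c P) ` chain_sums c P m"
  let ?S = "{F \<in> nonempty_faces P. apex c P \<notin> F}"
  let ?B = "\<Union>F\<in>?S. interior_chain_sums c F (Suc m)"
  have "x \<notin> ?B" if "x \<in> ?A" for x
  proof
    assume "x \<in> ?B"
    then obtain G where G: "G \<in> nonempty_faces P" "apex c P \<notin> G"
      and xG: "x \<in> interior_chain_sums c G (Suc m)"
      by blast
    obtain F where F: "face_chain P m F" and x: "x = apex c P + (\<Sum>i=1..m. apex c (F i))"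
      using \<open>x \<in> ?A\<close> by (auto simp: chain_sums_def)
    \<comment> \<open>The apex of \<open>P\<close> is placed at index 0, so that \<open>x\<close> is
      a sum over \<open>Suc m\<close> points of \<open>P\<close>. A face containing their average
      contains every one of them, in particular this apex.\<close>
    have sum: "x = (\<Sum>i\<in>{0..m}. if i = 0 then apex c P else apex c (F i))"
      unfolding x by (simp add: sum.atLeast_Suc_atMost)
    have "(1 / real (card {0..m})) *\<^sub>R x \<in> G"
      using xG chain_sums_face[OF P gen G(1), of "Suc m"] by (auto simp: interior_chain_sums_def)
    moreover have "(if i = 0 then apex c P else apex c (F i)) \<in> P" if "i \<in> {0..m}" for i
      using apex_in[OF P ne gen] apex_chain_in(2)[OF P gen F, of i] that by auto
    ultimately have "\<forall>i\<in>{0..m}. (if i = 0 then apex c P else apex c (F i)) \<in> G"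
      using average_in_face_iff[OF P, of G "{0..m}" "\<lambda>i. if i = 0 then apex c P else apex c (F i)"]
        G(1) unfolding sum nonempty_faces_def by auto
    then have "apex c P \<in> G"
      by (auto dest: bspec[of _ _ 0])
    then show False
      using G(2) by simp
  qed
  then have "?A \<inter> ?B = {}" by blast
  \<comment> \<open>Both are subsets of the finite set of all sums of length
    \<open>Suc m\<close>.\<close>
  moreover have "finite ?A" "finite ?B"
    using finite_chain_sums[OF P, of c] chain_sums_Suc[OF P gen ne, of m]
    by (simp, metis finite_Un)
  ultimately have "card (chain_sums c P (Suc m)) = card ?A + card ?B"
    unfolding chain_sums_Suc[OF P gen ne, of m] by (rule card_Un_disjoint[rotated 2])
  also have "card ?A = card (chain_sums c P m)"
    by (simp add: card_image)
  also have "card ?B = (\<Sum>F\<in>?S. card (interior_chain_sums c F (Suc m)))"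
    by (rule card_UN_interior[OF P gen]) auto
  finally show ?thesis by simp
qed

section \<open>Hull and average conditions compared\<close>

text \<open>The average is a point of the hull. Conversely, the boundary need not be convex, but an
  average in it lies in a single proper face, which then contains all the apexes and hence their
  hull.\<close>

lemma hull_chain_subset_boundary_iff:
  assumes P: "polytope P" and gen: "generic_on c P" and F: "face_chain P m F" and m: "m > 0"
  shows "convex hull ((\<lambda>i. apex c (F i)) ` {1..m}) \<subseteq> polytope_boundary P \<longleftrightarrow>
    (1 / real m) *\<^sub>R (\<Sum>i=1..m. apex c (F i)) \<in> polytope_boundary P"
    (is "?C \<subseteq> _ \<longleftrightarrow> ?y \<in> _")
proof
  have "(\<Sum>i=1..m. (1 / real m) *\<^sub>R apex c (F i)) \<in> ?C"
    using m by (intro convex_sum) (auto intro: hull_inc)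
  then have "?y \<in> ?C"
    by (simp add: scaleR_sum_right)
  then show "?y \<in> polytope_boundary P" if "?C \<subseteq> polytope_boundary P"
    using that by blast
next
  assume "?y \<in> polytope_boundary P"
  then obtain G where G: "G face_of P" "G \<noteq> P" "?y \<in> G"
    by (auto simp: polytope_boundary_def)
  then have "\<forall>i\<in>{1..m}. apex c (F i) \<in> G"
    using chain_average_in_face_iff[OF P gen F m] by blast
  then have "?C \<subseteq> G"
    using face_of_imp_convex[OF G(1)] by (intro hull_minimal) auto
  then show "?C \<subseteq> polytope_boundary P"
    using G by (auto simp: polytope_boundary_def)
qed

lemma interior_chain_sums_eq:
  assumes "polytope P" "generic_on c P" "m > 0"
  shows "interior_chain_sums c P m = {(\<Sum>i=1..m. apex c (F i)) | F. face_chain P m F \<and>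
    \<not> (convex hull ((\<lambda>i. apex c (F i)) ` {1..m}) \<subseteq> polytope_boundary P)}"
  using hull_chain_subset_boundary_iff[OF assms(1,2) _ assms(3)]
  unfolding interior_chain_sums_def chain_sums_def by blast

section \<open>Matching the recursions\<close>

lemma nonempty_faces_dim_0:
  assumes "polytope P" "aff_dim P = 0"
  shows "nonempty_faces P = {P}"
proof -
  obtain a where a: "P = {a}"
    using assms(2) aff_dim_eq_0 by blast
  have "F = P" if "F \<in> nonempty_faces P" for F
    using that face_of_imp_subset[of F P] unfolding nonempty_faces_def a by blast
  then show ?thesis
    using self_in_nonempty_faces[OF assms(1)] a by blast
qed

text \<open>In dimension 0 the defining recursion is not used, but for \<open>n \<ge> 2\<close> it holds there as well.\<close>

lemma polytope_number_rec:
  assumes "polytope P" "P \<noteq> {}" "generic_on c P" "n \<ge> 2"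
  shows "polytope_number c P n = polytope_number c P (n - 1)
    + (\<Sum>F\<in>{F \<in> nonempty_faces P. apex c P \<notin> F}. interior_polytope_number c F n)"
proof (cases "aff_dim P = 0")
  case True
  \<comment> \<open>A point is its own only nonempty face and contains its apex, so the sum is
    empty; both numbers are 1 because \<open>n - 1\<close> is still positive.\<close>
  then have no_face: "{F \<in> nonempty_faces P. apex c P \<notin> F} = {}"
    using nonempty_faces_dim_0[OF assms(1)] apex_in[OF assms(1-3)] by auto
  show ?thesis
    unfolding no_face using True assms by (simp add: polytope_number.simps)
next
  case False
  then show ?thesis
    using assms by (subst polytope_number.simps) simp
qed

lemma interior_polytope_number_rec:
  assumes "polytope P" "P \<noteq> {}" "generic_on c P" "n \<ge> 2"
  shows "interior_polytope_number c P n = polytope_number c P n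
    - (\<Sum>F\<in>nonempty_faces P - {P}. interior_polytope_number c F n)"
  using assms nonempty_faces_dim_0[OF assms(1)]
  by (simp add: polytope_number.simps[of c P n] interior_polytope_number.simps[of c P n])

lemma polytope_number_0: "polytope_number c P 0 = 0" "interior_polytope_number c P 0 = 0"
  by (simp_all add: polytope_number.simps interior_polytope_number.simps)

lemma polytope_number_1:
  "polytope P \<Longrightarrow> P \<noteq> {} \<Longrightarrow> generic_on c P \<Longrightarrow> polytope_number c P 1 = 1"
  by (simp add: polytope_number.simps)

text \<open>Induction on dimension, with an inner induction on \<open>m\<close> for the polytope
  numbers. The interior claim excludes \<open>m = 0\<close>: there
  \<open>interior_chain_sums\<close> depends on whether the origin lies in the boundary, whereas the
  interior number at 1 depends only on the dimension.\<close>

lemma polytope_numbers_eq_card: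
  fixes P :: "'a::euclidean_space set"
  assumes "polytope P" "P \<noteq> {}" "generic_on c P"
  shows "polytope_number c P (Suc m) = int (card (chain_sums c P m)) \<and>
    (m > 0 \<longrightarrow> interior_polytope_number c P (Suc m) = int (card (interior_chain_sums c P m)))"
  using assms
proof (induction "nat (aff_dim P)" arbitrary: P m rule: less_induct)
  case less
  note P = \<open>polytope P\<close> and ne = \<open>P \<noteq> {}\<close> and gen = \<open>generic_on c P\<close>
  have IH: "interior_polytope_number c F (Suc m) = int (card (interior_chain_sums c F m))"
    if F: "F \<in> nonempty_faces P" "F \<noteq> P" and m: "m > 0" for F m
  proof -
    have dom: "polytope F" "F \<noteq> {}" "generic_on c F"
      using face_in_domain[OF P gen F(1)] by auto
    have "aff_dim F < aff_dim P"
      using F face_of_aff_dim_lt[OF polytope_imp_convex[OF P]] by (auto simp: nonempty_faces_def)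
    \<comment> \<open>Nonnegativity keeps the inequality strict under \<open>nat\<close>.\<close>
    moreover have "aff_dim F \<ge> 0"
      using dom(2) aff_dim_negative_iff[of F] by linarith
    ultimately show ?thesis
      using less(1)[OF _ dom] m by simp
  qed
  have number: "polytope_number c P (Suc m) = int (card (chain_sums c P m))" for m
  proof (induction m)
    case 0
    then show ?case
      using polytope_number_1[OF P ne gen] by simp
  next
    case (Suc m)
    \<comment> \<open>Faces avoiding the apex are proper, so the hypothesis for lower dimension
      covers their interior numbers at the same index.\<close>
    have "F \<noteq> P" if "apex c P \<notin> F" for F
      using that apex_in[OF P ne gen] by blast
    then have "(\<Sum>F\<in>{F \<in> nonempty_faces P. apex c P \<notin> F}. interior_polytope_number c F (Suc (Suc m)))
      = (\<Sum>F\<in>{F \<in> nonempty_faces P. apex c P \<notin> F}. int (card (interior_chain_sums c F (Suc m))))"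
      using IH by (intro sum.cong) auto
    then show ?case
      using polytope_number_rec[OF P ne gen, of "Suc (Suc m)"] card_chain_sums_Suc[OF P gen ne, of m] Suc
      by simp
  qed
  have "interior_polytope_number c P (Suc m) = int (card (interior_chain_sums c P m))" if m: "m > 0"
  proof -
    have "(\<Sum>F\<in>nonempty_faces P - {P}. interior_polytope_number c F (Suc m))
      = (\<Sum>F\<in>nonempty_faces P - {P}. int (card (interior_chain_sums c F m)))"
      using IH m by (intro sum.cong) auto
    then show ?thesis
      using interior_polytope_number_rec[OF P ne gen, of "Suc m"] number[of m] m
        card_interior_chain_sums[OF P gen ne m] by simp
  qed
  then show ?case
    using number by blast
qed

theorem theorem3p4:
  fixes P :: "'a::euclidean_space set" and c :: 'a and d :: nat
  assumes "polytope P"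
    and "aff_dim P = int d"
    and "generic_on c P"
  shows "polytope_number c P 0 = int (card ({} :: 'a set)) \<and>
    interior_polytope_number c P 0 = int (card ({} :: 'a set)) \<and>
    card ({} :: 'a set) = 0 \<and>
    polytope_number c P 1 = int (card {0 :: 'a}) \<and>
    card {0 :: 'a} = 1 \<and>
    (d = 0 \<longrightarrow> interior_polytope_number c P 1 = int (card {0 :: 'a})) \<and>
    (d \<ge> 1 \<longrightarrow> interior_polytope_number c P 1 = int (card ({} :: 'a set))) \<and>
    (\<forall>n\<ge>2.
      polytope_number c P n =
        int (card {(\<Sum>i=1..n-1. apex c (F i)) | F. face_chain P (n - 1) F}) \<and>
      interior_polytope_number c P n =
        int (card {(\<Sum>i=1..n-1. apex c (F i)) | F. face_chain P (n - 1) F \<and>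
          \<not> (convex hull ((\<lambda>i. apex c (F i)) ` {1..n-1}) \<subseteq> polytope_boundary P)}))"
proof -
  \<comment> \<open>The empty set has affine dimension -1, which is not
    \<open>int d\<close>.\<close>
  have ne: "P \<noteq> {}"
    using assms(2) by auto
  have "polytope_number c P n = int (card (chain_sums c P (n - 1)))"
    "interior_polytope_number c P n = int (card (interior_chain_sums c P (n - 1)))"
    if "n \<ge> 2" for n
    using polytope_numbers_eq_card[OF assms(1) ne assms(3), of "n - 1"] that by auto
  then have "\<forall>n\<ge>2.
      polytope_number c P n =
        int (card {(\<Sum>i=1..n-1. apex c (F i)) | F. face_chain P (n - 1) F}) \<and>
      interior_polytope_number c P n =
        int (card {(\<Sum>i=1..n-1. apex c (F i)) | F. face_chain P (n - 1) F \<and>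
          \<not> (convex hull ((\<lambda>i. apex c (F i)) ` {1..n-1}) \<subseteq> polytope_boundary P)})"
    using interior_chain_sums_eq[OF assms(1,3)] by (simp add: chain_sums_def)
  moreover have "interior_polytope_number c P 1 = (if d = 0 then 1 else 0)"
    using assms ne by (simp add: interior_polytope_number.simps)
  ultimately show ?thesis
    using polytope_number_0[of c P] polytope_number_1[OF assms(1) ne assms(3)] by simp
qed

end
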